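(* Let $C(\mathbb{R})$ be the space of real-valued continuous functions on $\mathbb{R}$. For $n\in\mathbb{N}=\{0,1,2,\dots\}$ let $p_n(f)=\max_{x\in[-n,n]}|f(x)|$, and let $\{c_n\}_{n=0}^\infty$ be an arbitrary nonincreasing sequence of positive real numbers converging to zero. Define on $C(\mathbb{R})$ the metric $$d(f,g)=\sup_{n\in\mathbb{N}}\left\{c_n\frac{p_n(f-g)}{1+p_n(f-g)}\right\}.$$ Then $(C(\mathbb{R}),d)$ has the weak corona property.
   Context: For a metric space $(X,d)$, $\overline{B}(x,t)=\{y\in X: d(x,y)\le t\}$ denotes the closed ball with center $x$ and radius $t\ge 0$, and $d(y,A)=\inf_{a\in A}d(y,a)$ for nonempty $A\subset X$. $(X,d)$ has the weak corona property if for every $x\in X$, every $t\ge 0$ and every sequence $(y_n)$ in $X$, $\lim_{n\to\infty}d(x,y_n)=t$ implies $\lim_{n\to\infty}d(y_n,\overline{B}(x,t))=0$. *)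

theory Defs
  imports "HOL-Analysis.Analysis"
begin

context Metric_space
begin

text \<open>Only meaningful for \<open>y \<in> M\<close> and nonempty \<open>A \<subseteq> M\<close>; for \<open>A = {}\<close> the value is unspecified.\<close>

definition dist_to_set :: "'a \<Rightarrow> 'a set \<Rightarrow> real" where
  "dist_to_set y A = (INF a\<in>A. d y a)"

definition weak_corona_property :: bool where
  "weak_corona_property \<longleftrightarrow>
     (\<forall>x\<in>M. \<forall>t\<ge>0. \<forall>y::nat \<Rightarrow> 'a. range y \<subseteq> M \<longrightarrow>
        (\<lambda>n. d x (y n)) \<longlonglongrightarrow> t \<longrightarrow>
        (\<lambda>n. dist_to_set (y n) (mcball x t)) \<longlonglongrightarrow> 0)"

end

definition CR :: "(real \<Rightarrow> real) set" where
  "CR = {f. continuous_on UNIV f}"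

text \<open>For \<open>f \<in> CR\<close> the supremum is attained, hence it is the maximum
  (the constant \<open>Max\<close> is restricted to finite sets).\<close>

definition pnorm :: "nat \<Rightarrow> (real \<Rightarrow> real) \<Rightarrow> real" where
  "pnorm n f = (SUP x\<in>{- real n..real n}. \<bar>f x\<bar>)"

text \<open>The locale \<open>Metric_space\<close> requires nonnegativity and symmetry of the distance also
  outside the carrier, hence the value 0 there.\<close>

definition CR_dist :: "(nat \<Rightarrow> real) \<Rightarrow> (real \<Rightarrow> real) \<Rightarrow> (real \<Rightarrow> real) \<Rightarrow> real" where
  "CR_dist c f g =
     (if f \<in> CR \<and> g \<in> CR
      then SUP n. c n * (pnorm n (\<lambda>x. f x - g x) / (1 + pnorm n (\<lambda>x. f x - g x)))
      else 0)"

end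

theory Submission
  imports Defs
begin

text \<open>Write \<open>N(h) = sup\<^sub>k c\<^sub>k p\<^sub>k(h) / (1 + p\<^sub>k(h))\<close>, so that \<open>d(f, g) = N(f - g)\<close>. For
  \<open>0 < t < c\<^sub>0\<close> let \<open>m\<close> be the last index with \<open>c\<^sub>m > t\<close>. Then \<open>N(g) \<le> t\<close> only constrains
  \<open>g\<close> on \<open>[-m, m]\<close>: it says \<open>p\<^sub>k(g) \<le> t / (c\<^sub>k - t)\<close> for \<open>k \<le> m\<close>. Given \<open>h\<close> with
  \<open>t < s = N(h) < c\<^sub>m\<close>, scaling \<open>h\<close> on \<open>[-m, m]\<close> by
  \<open>\<lambda> = t (c\<^sub>m - s) / (s (c\<^sub>m - t))\<close> achieves all these bounds at once, because
  \<open>(c - s) / (c - t)\<close> increases with \<open>c\<close>. Extending the correction \<open>(1 - \<lambda>) h\<close> by constants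
  outside \<open>[-m, m]\<close> keeps it continuous and uniformly bounded by
  \<open>s / (c\<^sub>m - s) - t / (c\<^sub>m - t)\<close>, which tends to \<open>0\<close> as \<open>s\<close> tends to \<open>t\<close>.\<close>

section \<open>Seminorms on compact intervals and the size functional\<close>

definition CR_size :: "(nat \<Rightarrow> real) \<Rightarrow> (real \<Rightarrow> real) \<Rightarrow> real" where
  "CR_size c f = (SUP n. c n * (pnorm n f / (1 + pnorm n f)))"

lemma CR_dist_eq_CR_size:
  "f \<in> CR \<Longrightarrow> g \<in> CR \<Longrightarrow> CR_dist c f g = CR_size c (\<lambda>x. f x - g x)"
  by (simp add: CR_dist_def CR_size_def)

lemma CR_diff: "f \<in> CR \<Longrightarrow> g \<in> CR \<Longrightarrow> (\<lambda>x. f x - g x) \<in> CR"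
  by (auto simp: CR_def intro: continuous_intros)

lemma abs_le_pnorm:
  assumes "f \<in> CR" "\<bar>x\<bar> \<le> real n"
  shows "\<bar>f x\<bar> \<le> pnorm n f"
proof -
  have "continuous_on {- real n..real n} (\<lambda>x. \<bar>f x\<bar>)"
    using assms(1) unfolding CR_def
    by (auto intro!: continuous_intros intro: continuous_on_subset)
  then have "bdd_above ((\<lambda>x. \<bar>f x\<bar>) ` {- real n..real n})"
    by (intro bounded_imp_bdd_above compact_imp_bounded compact_continuous_image) auto
  then show ?thesis
    unfolding pnorm_def using assms(2) by (intro cSUP_upper) auto
qed

lemma pnorm_le:
  assumes "\<And>x. \<bar>x\<bar> \<le> real n \<Longrightarrow> \<bar>f x\<bar> \<le> b"
  shows "pnorm n f \<le> b"
  unfolding pnorm_def by (rule cSUP_least) (auto intro: assms)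

lemma pnorm_nonneg: "f \<in> CR \<Longrightarrow> 0 \<le> pnorm n f"
  using abs_le_pnorm[of f 0 n] by simp

lemma pnorm_minus: "pnorm n (\<lambda>x. - f x) = pnorm n f"
  by (simp add: pnorm_def)

lemma pnorm_triangle:
  assumes "f \<in> CR" "g \<in> CR"
  shows "pnorm n (\<lambda>x. f x + g x) \<le> pnorm n f + pnorm n g"
proof (rule pnorm_le)
  fix x :: real assume "\<bar>x\<bar> \<le> real n"
  then show "\<bar>f x + g x\<bar> \<le> pnorm n f + pnorm n g"
    using abs_le_pnorm[OF assms(1)] abs_le_pnorm[OF assms(2)]
    by (meson abs_triangle_ineq add_mono order_trans)
qed

text \<open>The map \<open>u / (1 + u)\<close> is increasing, which replaces \<open>p\<close> by
  \<open>a + b\<close>; after splitting the fraction, each summand only grows when the other term is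
  dropped from its denominator.\<close>

lemma frac_subadditive:
  fixes a b p :: real
  assumes "0 \<le> a" "0 \<le> b" "0 \<le> p" "p \<le> a + b"
  shows "p / (1 + p) \<le> a / (1 + a) + b / (1 + b)"
proof -
  have "p / (1 + p) \<le> (a + b) / (1 + (a + b))"
    using assms by (simp add: field_simps)
  also have "\<dots> = a / (1 + (a + b)) + b / (1 + (a + b))"
    by (simp add: add_divide_distrib)
  also have "\<dots> \<le> a / (1 + a) + b / (1 + b)"
    using assms by (intro add_mono divide_left_mono) auto
  finally show ?thesis .
qed

lemma CR_size_minus: "CR_size c (\<lambda>x. - f x) = CR_size c f"
  by (simp add: CR_size_def pnorm_minus)

section \<open>The metric axioms\<close>

context
  fixes c :: "nat \<Rightarrow> real"
  assumes c_pos: "\<And>n. c n > 0" and c_dec: "decseq c"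
begin

text \<open>The fraction is below 1. Hence an index with \<open>c n \<le> t\<close> cannot push the
  size above \<open>t\<close>, however large the function is on \<open>[-n, n]\<close>.\<close>

lemma term_le_coeff:
  assumes "f \<in> CR"
  shows "c n * (pnorm n f / (1 + pnorm n f)) \<le> c n"
  using c_pos[of n] pnorm_nonneg[OF assms, of n] by (simp add: field_simps)

lemma term_le_CR_size:
  assumes "f \<in> CR"
  shows "c n * (pnorm n f / (1 + pnorm n f)) \<le> CR_size c f"
proof -
  have "c k * (pnorm k f / (1 + pnorm k f)) \<le> c 0" for k
    using term_le_coeff[OF assms, of k] decseqD[OF c_dec, of 0 k] by simp
  then have "bdd_above (range (\<lambda>n. c n * (pnorm n f / (1 + pnorm n f))))"
    by (intro bdd_aboveI2)
  then show ?thesis unfolding CR_size_def by (intro cSUP_upper) auto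
qed

lemma CR_size_le:
  assumes "\<And>n. c n * (pnorm n f / (1 + pnorm n f)) \<le> b"
  shows "CR_size c f \<le> b"
  unfolding CR_size_def by (rule cSUP_least) (use assms in auto)

lemma CR_size_nonneg:
  assumes "f \<in> CR"
  shows "0 \<le> CR_size c f"
proof -
  have "0 \<le> c 0 * (pnorm 0 f / (1 + pnorm 0 f))"
    using c_pos[of 0] pnorm_nonneg[OF assms, of 0] by simp
  then show ?thesis using term_le_CR_size[OF assms, of 0] by linarith
qed

lemma CR_size_le_coeff0:
  assumes "f \<in> CR"
  shows "CR_size c f \<le> c 0"
proof (rule CR_size_le)
  show "c n * (pnorm n f / (1 + pnorm n f)) \<le> c 0" for n
    using term_le_coeff[OF assms, of n] decseqD[OF c_dec, of 0 n] by simp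
qed

lemma CR_size_triangle:
  assumes "f \<in> CR" "g \<in> CR" "(\<lambda>x. f x + g x) \<in> CR"
  shows "CR_size c (\<lambda>x. f x + g x) \<le> CR_size c f + CR_size c g"
proof (rule CR_size_le)
  fix n
  let ?\<phi> = "\<lambda>h. pnorm n h / (1 + pnorm n h)"
  have "?\<phi> (\<lambda>x. f x + g x) \<le> ?\<phi> f + ?\<phi> g"
    by (intro frac_subadditive pnorm_nonneg pnorm_triangle assms)
  then have "c n * ?\<phi> (\<lambda>x. f x + g x) \<le> c n * (?\<phi> f + ?\<phi> g)"
    using c_pos[of n] by (intro mult_left_mono) auto
  also have "\<dots> = c n * ?\<phi> f + c n * ?\<phi> g"
    by (rule distrib_left)
  also have "\<dots> \<le> CR_size c f + CR_size c g"
    by (intro add_mono term_le_CR_size assms)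
  finally show "c n * ?\<phi> (\<lambda>x. f x + g x) \<le> CR_size c f + CR_size c g" .
qed

lemma CR_size_eq_0_iff:
  assumes "f \<in> CR"
  shows "CR_size c f = 0 \<longleftrightarrow> (\<forall>x. f x = 0)"
proof
  assume size: "CR_size c f = 0"
  show "\<forall>x. f x = 0"
  proof
    fix x
    obtain n where n: "\<bar>x\<bar> \<le> real n" using real_arch_simple by blast
    have "c n * (pnorm n f / (1 + pnorm n f)) \<le> 0"
      using term_le_CR_size[OF assms, of n] size by simp
    then have "pnorm n f \<le> 0"
      using c_pos[of n] pnorm_nonneg[OF assms, of n]
      by (auto simp: mult_le_0_iff divide_le_0_iff)
    then show "f x = 0" using abs_le_pnorm[OF assms n] by simp
  qed
next
  assume "\<forall>x. f x = 0"
  then have "pnorm n f \<le> 0" for n by (intro pnorm_le) simp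
  then have "pnorm n f = 0" for n using pnorm_nonneg[OF assms] by (simp add: antisym)
  then show "CR_size c f = 0" by (simp add: CR_size_def)
qed

lemma Metric_space_CR: "Metric_space CR (CR_dist c)"
proof
  fix f g
  have "CR_size c (\<lambda>x. g x - f x) = CR_size c (\<lambda>x. f x - g x)"
    using CR_size_minus[of c "\<lambda>x. f x - g x"] by simp
  then show "CR_dist c f g = CR_dist c g f"
    by (simp add: CR_dist_def CR_size_def)
  show "0 \<le> CR_dist c f g"
    using CR_size_nonneg[OF CR_diff, of f g] CR_dist_eq_CR_size[of f g c]
    by (cases "f \<in> CR \<and> g \<in> CR") (auto simp: CR_dist_def)
next
  fix f g assume "f \<in> CR" "g \<in> CR"
  then show "CR_dist c f g = 0 \<longleftrightarrow> f = g"
    by (simp add: CR_dist_eq_CR_size CR_size_eq_0_iff CR_diff fun_eq_iff)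
next
  fix f g h assume "f \<in> CR" "g \<in> CR" "h \<in> CR"
  then show "CR_dist c f h \<le> CR_dist c f g + CR_dist c g h"
    using CR_size_triangle[of "\<lambda>x. f x - g x" "\<lambda>x. g x - h x"]
    by (simp add: CR_dist_eq_CR_size CR_diff)
qed

section \<open>Shrinking a function to a prescribed size\<close>

lemma pnorm_le_of_CR_size:
  assumes "f \<in> CR" "CR_size c f < c k"
  shows "pnorm k f \<le> CR_size c f / (c k - CR_size c f)"
proof -
  have "c k * (pnorm k f / (1 + pnorm k f)) \<le> CR_size c f"
    by (rule term_le_CR_size[OF assms(1)])
  \<comment> \<open>Solve \<open>c k * (p / (1 + p)) \<le> s\<close> for \<open>p\<close>, with
    \<open>s\<close> the size; \<open>s < c k\<close> makes the divisor positive.\<close>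
  then show ?thesis
    using assms(2) pnorm_nonneg[OF assms(1), of k] by (simp add: field_simps)
qed

text \<open>\<open>\<psi> u m\<close> is the bound that size \<open>u < c m\<close> imposes on
  \<open>pnorm m\<close>. The error depends on \<open>h\<close> only through its size, so for fixed
  \<open>t\<close> and \<open>m\<close> it vanishes uniformly as the size tends to
  \<open>t\<close>.\<close>

lemma CR_size_approx:
  fixes t :: real
  defines "\<psi> \<equiv> \<lambda>u m. u / (c m - u)"
  assumes h: "h \<in> CR" and t: "0 < t" "t < CR_size c h" "CR_size c h < c m"
    and tail: "\<And>k. k > m \<Longrightarrow> c k \<le> t"
  shows "\<exists>g\<in>CR. CR_size c g \<le> t \<and>
    CR_size c (\<lambda>x. h x - g x) \<le> c 0 * (\<psi> (CR_size c h) m - \<psi> t m)"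
proof -
  define s where "s = CR_size c h"
  have st: "0 < s" "t < s" "s < c m" "t < c m" using t by (auto simp: s_def)
  \<comment> \<open>This is the quotient of \<open>\<psi> t m\<close> by \<open>\<psi> s m\<close>:
    it turns the bound at index \<open>m\<close> for size \<open>s\<close> into the one for size
    \<open>t\<close>.\<close>
  define l where "l = t * (c m - s) / (s * (c m - t))"
  define clip :: "real \<Rightarrow> real" where "clip x = max (- real m) (min (real m) x)" for x
  \<comment> \<open>On \<open>[-m, m]\<close>, \<open>g\<close> is \<open>l * h\<close>; everywhere,
    \<open>h - g\<close> only involves values of \<open>h\<close> on \<open>[-m, m]\<close>.\<close>
  define g where "g x = h x - (1 - l) * h (clip x)" for x
  have l: "0 \<le> l" "l \<le> 1"
    using st t(1) by (auto simp: l_def field_simps)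
  have "l * \<psi> s m = \<psi> t m"
    using st by (simp add: l_def \<psi>_def)
  then have gap: "(1 - l) * \<psi> s m = \<psi> s m - \<psi> t m"
    by (simp add: left_diff_distrib)
  have cont: "continuous_on UNIV h" using h by (simp add: CR_def)
  have "continuous_on UNIV (\<lambda>x. h (clip x))"
    unfolding clip_def
    by (rule continuous_on_compose2[OF cont]) (auto intro!: continuous_intros)
  then have gC: "g \<in> CR"
    unfolding CR_def g_def by (auto intro!: continuous_intros cont)
  have "CR_size c g \<le> t"
  proof (rule CR_size_le)
    fix k
    show "c k * (pnorm k g / (1 + pnorm k g)) \<le> t"
    proof (cases "k \<le> m")
      case False
      then show ?thesis using term_le_coeff[OF gC, of k] tail[of k] by simp
    next
      case True
      then have ck: "c m \<le> c k" using c_dec by (simp add: decseqD)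
      have "pnorm k g \<le> l * pnorm k h"
      proof (rule pnorm_le)
        fix x :: real assume x: "\<bar>x\<bar> \<le> real k"
        then have "clip x = x" using True by (auto simp: clip_def)
        then have "\<bar>g x\<bar> = l * \<bar>h x\<bar>"
          using l by (simp add: g_def algebra_simps abs_mult)
        then show "\<bar>g x\<bar> \<le> l * pnorm k h"
          using abs_le_pnorm[OF h x] l by (simp add: mult_left_mono)
      qed
      also have "\<dots> \<le> l * (s / (c k - s))"
        using pnorm_le_of_CR_size[OF h, of k] ck st l
        by (intro mult_left_mono) (auto simp: s_def)
      also have "\<dots> = t * ((c m - s) / ((c m - t) * (c k - s)))"
        using st by (simp add: l_def)
      also have "\<dots> \<le> t * (1 / (c k - t))"
      proof (intro mult_left_mono)
        \<comment> \<open>This product is exactly the difference of the two cross products compared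
          next, so \<open>m\<close> is the most restrictive index.\<close>
        have "0 \<le> (s - t) * (c k - c m)" using st ck by simp
        then have "(c m - s) * (c k - t) \<le> (c m - t) * (c k - s)"
          by (simp add: algebra_simps)
        then show "(c m - s) / ((c m - t) * (c k - s)) \<le> 1 / (c k - t)"
          using st ck by (simp add: pos_divide_le_eq pos_le_divide_eq)
      qed (use t in simp)
      finally have "pnorm k g * (c k - t) \<le> t"
        using st ck by (simp add: pos_le_divide_eq)
      then show ?thesis
        using pnorm_nonneg[OF gC, of k] by (simp add: field_simps)
    qed
  qed
  moreover have "CR_size c (\<lambda>x. h x - g x) \<le> c 0 * (\<psi> s m - \<psi> t m)"
  proof (rule CR_size_le)
    fix k
    let ?p = "pnorm k (\<lambda>x. h x - g x)"
    have p0: "0 \<le> ?p" by (intro pnorm_nonneg CR_diff h gC)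
    have "?p \<le> (1 - l) * \<psi> s m"
    proof (rule pnorm_le)
      fix x :: real
      \<comment> \<open>\<open>clip x\<close> lies in \<open>[-m, m]\<close> for every real
        \<open>x\<close>, so the bound is the same for all \<open>k\<close>.\<close>
      have "\<bar>h (clip x)\<bar> \<le> pnorm m h"
        by (rule abs_le_pnorm[OF h]) (auto simp: clip_def)
      also have "\<dots> \<le> \<psi> s m"
        using pnorm_le_of_CR_size[OF h, of m] t by (simp add: s_def \<psi>_def)
      finally show "\<bar>h x - g x\<bar> \<le> (1 - l) * \<psi> s m"
        using l by (simp add: g_def abs_mult mult_left_mono)
    qed
    moreover have "?p / (1 + ?p) \<le> ?p"
      using p0 by (simp add: field_simps)
    ultimately have "?p / (1 + ?p) \<le> \<psi> s m - \<psi> t m"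
      using gap by simp
    then show "c k * (?p / (1 + ?p)) \<le> c 0 * (\<psi> s m - \<psi> t m)"
      using c_pos[of 0] p0 decseqD[OF c_dec, of 0 k] by (intro mult_mono) auto
  qed
  ultimately show ?thesis using gC unfolding s_def by blast
qed

section \<open>The weak corona property\<close>

lemma weak_corona_property_CR:
  assumes lim: "c \<longlonglongrightarrow> 0"
  shows "Metric_space.weak_corona_property CR (CR_dist c)"
proof -
  interpret Metric_space CR "CR_dist c" by (rule Metric_space_CR)
  have dist_le: "dist_to_set y A \<le> CR_dist c y a" if "a \<in> A" for y A a
    unfolding dist_to_set_def by (rule cINF_lower[OF bdd_belowI2[of _ 0]]) (auto simp: that)
  have dist_nonneg: "0 \<le> dist_to_set y A" if "A \<noteq> {}" for y A
    unfolding dist_to_set_def using that by (rule cINF_greatest) auto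
  show ?thesis
    unfolding weak_corona_property_def
  proof (intro ballI allI impI)
    fix f t and y :: "nat \<Rightarrow> real \<Rightarrow> real"
    assume f: "f \<in> CR" and t: "0 \<le> t" and "range y \<subseteq> CR"
      and conv: "(\<lambda>n. CR_dist c f (y n)) \<longlonglongrightarrow> t"
    then have y: "y n \<in> CR" for n by auto
    let ?B = "mcball f t"
    have fB: "f \<in> ?B" using f t by simp
    have nonneg: "0 \<le> dist_to_set (y n) ?B" for n
      using fB by (intro dist_nonneg) blast
    have inside: "dist_to_set (y n) ?B \<le> 0" if "CR_dist c f (y n) \<le> t" for n
      using dist_le[of "y n" ?B "y n"] that f y by simp
    \<comment> \<open>For \<open>t = 0\<close> the center \<open>f\<close> itself serves as
      approximant; for \<open>c 0 \<le> t\<close> the ball is the whole space.\<close>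
    consider "t = 0" | "c 0 \<le> t" | "0 < t" "t < c 0" using t by linarith
    then show "(\<lambda>n. dist_to_set (y n) ?B) \<longlonglongrightarrow> 0"
    proof cases
      case 1
      have "dist_to_set (y n) ?B \<le> CR_dist c f (y n)" for n
        using dist_le[OF fB, of "y n"] commute[of f "y n"] by simp
      then show ?thesis
        using conv 1 nonneg by (intro tendsto_sandwich[OF _ _ tendsto_const conv[unfolded 1]]) auto
    next
      case 2
      have "dist_to_set (y n) ?B = 0" for n
        using inside[of n] nonneg[of n] CR_size_le_coeff0[OF CR_diff[OF f y[of n]]] 2
        by (simp add: CR_dist_eq_CR_size f y)
      then show ?thesis by simp
    next
      case 3
      obtain k where k: "c k < t"
        using order_tendstoD(2)[OF lim 3(1)] by (auto simp: eventually_sequentially)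
      \<comment> \<open>\<open>M\<close> is positive because \<open>t < c 0\<close>; its predecessor
        is the last index with coefficient above \<open>t\<close>.\<close>
      define M where "M = (LEAST k. c k \<le> t)"
      have M: "c M \<le> t" unfolding M_def by (rule LeastI[of _ k]) (use k in simp)
      then obtain m where m: "M = Suc m" using 3 by (cases M) auto
      have cm: "t < c m"
        using not_less_Least[of m "\<lambda>k. c k \<le> t"] m M_def by auto
      have tail: "c j \<le> t" if "j > m" for j
        using decseqD[OF c_dec, of M j] M m that by simp
      \<comment> \<open>The absolute value keeps the majorant nonnegative when the distance is at
        most \<open>t\<close>, so one null sequence covers both cases.\<close>
      define e where
        "e u = c 0 * \<bar>u / (c m - u) - t / (c m - t)\<bar>" for u
      have "(\<lambda>n. e (CR_dist c f (y n))) \<longlonglongrightarrow> c 0 * \<bar>t / (c m - t) - t / (c m - t)\<bar>"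
        unfolding e_def using cm by (intro tendsto_intros conv) auto
      then have e0: "(\<lambda>n. e (CR_dist c f (y n))) \<longlonglongrightarrow> 0" by simp
      have bound: "dist_to_set (y n) ?B \<le> e (CR_dist c f (y n))"
        if less: "CR_dist c f (y n) < c m" for n
      proof (cases "CR_dist c f (y n) \<le> t")
        case True
        have "0 \<le> e (CR_dist c f (y n))" using c_pos[of 0] by (simp add: e_def)
        then show ?thesis using inside[OF True] by linarith
      next
        case False
        define h where "h x = f x - y n x" for x
        have h: "h \<in> CR" unfolding h_def by (intro CR_diff f y)
        have dh: "CR_dist c f (y n) = CR_size c h"
          by (simp add: CR_dist_eq_CR_size f y h_def[abs_def])
        obtain g where g: "g \<in> CR" "CR_size c g \<le> t"
          "CR_size c (\<lambda>x. h x - g x) \<le> c 0 * (CR_size c h / (c m - CR_size c h) - t / (c m - t))"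
          using CR_size_approx[OF h 3(1) _ _ tail] False less dh by auto
        \<comment> \<open>Translate back: \<open>f - a = g\<close> puts \<open>a\<close> in the
          ball, and \<open>a - y n = h - g\<close> is the small error.\<close>
        define a where "a x = f x - g x" for x
        have a: "a \<in> CR" unfolding a_def by (intro CR_diff f g)
        have "CR_dist c f a \<le> t"
          using g by (simp add: CR_dist_eq_CR_size f a) (simp add: a_def)
        then have "dist_to_set (y n) ?B \<le> CR_dist c (y n) a"
          using f a by (intro dist_le) simp
        also have "\<dots> = CR_dist c a (y n)" by (rule commute)
        also have "\<dots> = CR_size c (\<lambda>x. h x - g x)"
          by (simp add: CR_dist_eq_CR_size a y) (simp add: a_def h_def algebra_simps)
        also have "\<dots> \<le> c 0 * (CR_size c h / (c m - CR_size c h) - t / (c m - t))"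
          by (rule g)
        also have "\<dots> \<le> e (CR_dist c f (y n))"
          unfolding e_def dh using c_pos[of 0] by (intro mult_left_mono) auto
        finally show ?thesis .
      qed
      \<comment> \<open>Since \<open>t < c m\<close>, the distances eventually drop below
        \<open>c m\<close>, where \<open>bound\<close> applies.\<close>
      have "\<forall>\<^sub>F n in sequentially. dist_to_set (y n) ?B \<le> e (CR_dist c f (y n))"
        using order_tendstoD(2)[OF conv cm] by eventually_elim (rule bound)
      then show ?thesis
        using nonneg by (intro tendsto_sandwich[OF _ _ tendsto_const e0]) auto
    qed
  qed
qed

end

theorem theorem7:
  fixes c :: "nat \<Rightarrow> real"
  assumes "\<And>n. c n > 0"
    and "decseq c"
    and "c \<longlonglongrightarrow> 0"
  shows "Metric_space CR (CR_dist c) \<and> Metric_space.weak_corona_property CR (CR_dist c)"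
  using Metric_space_CR weak_corona_property_CR assms by blast

end
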